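(* Let $n\ge 1$ be an integer, let $\mathbb{F}\in\{\mathbb{R},\mathbb{C}\}$, and let $V$ be an $n$-dimensional linear space over $\mathbb{F}$ equipped with a scalar product $\langle\cdot,\cdot\rangle:V\times V\to\mathbb{F}$. For any norm $f:V\to\mathbb{R}^+$, any $f$-maximal basis $(b_1,b_2,\dots,b_n)$ of $V$, and every $v\in V$, $$(2^n-1)\,f(v)\ \ge\ \sum_{i=1}^n |\langle v,b_i\rangle|\, f(b_i).$$
   Context: $\mathbb{R}^+$ denotes the non-negative reals. $\mathbb{S}_1=\{u\in V: \langle u,u\rangle=1\}$ is the unit sphere of the scalar product; the norm $f$ is arbitrary and need not be related to the scalar product. An $f$-maximal basis is an (ordered, orthonormal) basis of $V$ defined inductively on $n=\dim V$. If $n=1$, then $(b)$ is $f$-maximal for any $b\in\mathbb{S}_1$. If $n>1$, choose $b_1\in\arg\max\{f(b): b\in\mathbb{S}_1\}$, let $V_1=\{u\in V:\langle u,b_1\rangle=0\}$ and let $f_1=f\upharpoonright V_1$ be the restriction of $f$ to $V_1$; if $(b_2,\dots,b_n)$ is an $f_1$-maximal basis of $V_1$, then $(b_1,b_2,\dots,b_n)$ is an $f$-maximal basis of $V$. *)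

theory Defs
  imports "HOL-Analysis.Analysis"
begin

(* The parameter conj is the conjugation of the scalar field: the identity over the reals
   and cnj over the complex numbers. Scalar products are linear in the first argument. *)
locale scalar_product_space = vector_space scale
  for scale :: "'f::real_normed_field \<Rightarrow> 'v::ab_group_add \<Rightarrow> 'v" +
  fixes conj :: "'f \<Rightarrow> 'f"
    and ip :: "'v \<Rightarrow> 'v \<Rightarrow> 'f"
  assumes ip_add_left: "ip (u + v) w = ip u w + ip v w"
    and ip_scale_left: "ip (scale a u) v = a * ip u v"
    and ip_conj: "ip u v = conj (ip v u)"
    and ip_pos: "u \<noteq> 0 \<Longrightarrow> \<exists>r>0. ip u u = of_real r"

(* An arbitrary norm, not tied to any scalar product or to the topology of the type. *)
locale norm_on_vector_space = vector_space scale
  for scale :: "'f::real_normed_field \<Rightarrow> 'v::ab_group_add \<Rightarrow> 'v" +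
  fixes f :: "'v \<Rightarrow> real"
  assumes norm_nonneg: "f u \<ge> 0"
    and norm_eq_0: "f u = 0 \<longleftrightarrow> u = 0"
    and norm_triangle: "f (u + v) \<le> f u + f v"
    and norm_scale: "f (scale a u) = norm a * f u"

context scalar_product_space
begin

definition unit_sphere :: "'v set" where
  "unit_sphere = {u. ip u u = 1}"

(* maximal_basis f U bs: the list bs is an f-maximal basis of the subspace U.
   Restricting f to a subspace amounts to changing U only. *)
inductive maximal_basis :: "('v \<Rightarrow> real) \<Rightarrow> 'v set \<Rightarrow> 'v list \<Rightarrow> bool" for f where
  one: "dim U = 1 \<Longrightarrow> b \<in> U \<inter> unit_sphere \<Longrightarrow> maximal_basis f U [b]"
| step: "dim U > 1 \<Longrightarrow> is_arg_max f (\<lambda>b. b \<in> U \<inter> unit_sphere) b \<Longrightarrow>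
    maximal_basis f {u \<in> U. ip u b = 0} bs \<Longrightarrow> maximal_basis f U (b # bs)"

end

end

theory Submission
  imports Defs
begin

text \<open>If \<open>b\<close> maximises \<open>f\<close> on the unit sphere, the \<open>f\<close>-ball of radius \<open>f b\<close> contains the Euclidean
  unit ball and touches it at \<open>b\<close>, so its supporting hyperplane at \<open>b\<close> is orthogonal to \<open>b\<close>. Hence
  \<open>\<bar>\<langle>v,b\<rangle>\<bar> f(b) \<le> f(v)\<close>, and the projection \<open>w\<close> of \<open>v\<close> to the orthogonal complement of \<open>b\<close> satisfies
  \<open>f(w) \<le> 2 f(v)\<close>. Induction on the dimension gives the constants \<open>c\<^sub>1 = 1\<close>, \<open>c\<^sub>n = 1 + 2 c\<^sub>n\<^sub>-\<^sub>1\<close>.\<close>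

text \<open>The identity on the reals and \<open>cnj\<close> both fix the embedded reals. Together
  with \<open>ip_conj\<close> this is all the argument uses about \<open>conj\<close>, so one proof
  serves both fields.\<close>

locale normed_scalar_product_space =
  scalar_product_space scale conj ip + norm_on_vector_space scale f
  for scale :: "'f::real_normed_field \<Rightarrow> 'v::ab_group_add \<Rightarrow> 'v" and conj ip f +
  assumes conj_of_real: "conj (of_real r) = of_real r"
begin

section \<open>Elementary identities for the scalar product\<close>

lemma ip_zero_left: "ip 0 u = 0"
  using ip_scale_left[of 0 0 u] by simp

lemma ip_diff_left: "ip (u - v) w = ip u w - ip v w"
  using ip_add_left[of "u - v" v w] by simp

lemma ip_orthogonal_sym: "ip u v = 0 \<Longrightarrow> ip v u = 0"
  using ip_conj[of v u] conj_of_real[of 0] by simp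

lemma ip_self_real: "\<exists>r\<ge>0. ip u u = of_real r"
  by (metis ip_pos ip_zero_left less_eq_real_def of_real_0)

text \<open>Linearity in the second argument is not an axiom. Whenever the value is real,
  \<open>ip_conj\<close> swaps the arguments without changing it, which suffices for real
  scalars.\<close>

lemma ip_scale_self:
  assumes "ip u u = of_real r"
  shows "ip (scale (of_real c) u) (scale (of_real c) u) = of_real (c\<^sup>2 * r)"
proof -
  have "ip (scale (of_real c) u) u = of_real (c * r)"
    by (simp add: ip_scale_left assms)
  then have "ip u (scale (of_real c) u) = of_real (c * r)"
    by (metis ip_conj conj_of_real)
  then show ?thesis by (simp add: ip_scale_left power2_eq_square mult.assoc)
qed

text \<open>An orthogonal move away from \<open>b\<close> changes the squared Euclidean norm only to
  second order in \<open>t\<close>; the variation in \<open>norm_arg_max_le\<close> rests on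
  this.\<close>

lemma ip_pythagoras:
  assumes b: "ip b b = 1" and w: "ip w b = 0" "ip w w = of_real r"
  shows "ip (b - scale (of_real t) w) (b - scale (of_real t) w) = of_real (1 + t\<^sup>2 * r)"
proof -
  let ?x = "b - scale (of_real t) w"
  have "ip ?x b = of_real 1"
    using b w by (simp add: ip_diff_left ip_scale_left)
  then have 1: "ip b ?x = 1" by (metis ip_conj conj_of_real of_real_1)
  have "ip ?x w = of_real (- t * r)"
    using w ip_orthogonal_sym[OF w(1)] by (simp add: ip_diff_left ip_scale_left)
  then have 2: "ip w ?x = of_real (- t * r)" by (metis ip_conj conj_of_real)
  show ?thesis
    by (simp add: ip_diff_left[of b] ip_scale_left 1 2 power2_eq_square mult.assoc)
qed

section \<open>The supporting hyperplane at a maximiser\<close>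

lemma norm_le_arg_max:
  assumes U: "subspace U" and b: "is_arg_max f (\<lambda>b. b \<in> U \<inter> unit_sphere) b"
    and x: "x \<in> U" "ip x x = of_real r" and r: "r > 0"
  shows "f x \<le> sqrt r * f b"
proof -
  let ?y = "scale (of_real (1 / sqrt r)) x"
  have "ip ?y ?y = 1"
    using ip_scale_self[OF x(2), of "1 / sqrt r"] r by (simp add: power_divide)
  then have "?y \<in> U \<inter> unit_sphere"
    using x(1) U by (simp add: unit_sphere_def subspace_scale)
  then have "f ?y \<le> f b"
    using b unfolding is_arg_max_def by (meson not_le)
  moreover have "f ?y = f x / sqrt r"
    using r by (simp add: norm_scale norm_divide)
  ultimately have "f x / sqrt r \<le> f b" by linarith
  then show ?thesis using r by (simp add: pos_divide_le_eq mult.commute)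
qed

text \<open>Support of the \<open>f\<close>-ball at \<open>b\<close>, stated without functionals and
  obtained by a variation in \<open>t\<close> rather than from a separation theorem.\<close>

lemma norm_arg_max_le:
  assumes U: "subspace U" and b: "is_arg_max f (\<lambda>b. b \<in> U \<inter> unit_sphere) b"
    and w: "w \<in> U" "ip w b = 0"
  shows "f b \<le> f (b + w)"
proof -
  have bU: "b \<in> U" and bb: "ip b b = 1"
    using b by (auto simp: is_arg_max_def unit_sphere_def)
  obtain r where r: "r \<ge> 0" "ip w w = of_real r"
    using ip_self_real by blast
  text \<open>\<open>b\<close> is a convex combination of \<open>b + w\<close> and \<open>b - t w\<close>, and the latter has Euclidean norm
    \<open>1 + O(t\<^sup>2)\<close>; so the claim holds up to an error \<open>O(t)\<close>.\<close>
  have approx: "(1 - t * r / 2) * f b \<le> f (b + w)" if t: "t > 0" for t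
  proof -
    let ?x = "b - scale (of_real t) w"
    have pos: "0 < 1 + t\<^sup>2 * r" using r by (simp add: add_pos_nonneg)
    have "f ?x \<le> sqrt (1 + t\<^sup>2 * r) * f b"
      using norm_le_arg_max[OF U b _ ip_pythagoras[OF bb w(2) r(2)] pos] U bU w(1)
      by (simp add: subspace_diff subspace_scale)
    also have "\<dots> \<le> (1 + t\<^sup>2 * r / 2) * f b"
    proof (rule mult_right_mono[OF _ norm_nonneg])
      have "1 + t\<^sup>2 * r \<le> (1 + t\<^sup>2 * r / 2)\<^sup>2"
        by (simp add: power2_sum)
      then show "sqrt (1 + t\<^sup>2 * r) \<le> 1 + t\<^sup>2 * r / 2"
        using r by (intro real_le_lsqrt) auto
    qed
    finally have x: "f ?x \<le> (1 + t\<^sup>2 * r / 2) * f b" .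
    have "scale (of_real (1 + t)) b = scale (of_real t) (b + w) + ?x"
      by (simp add: scale_right_distrib scale_left_distrib)
    then have "(1 + t) * f b = f (scale (of_real t) (b + w) + ?x)"
      using t norm_scale[of "of_real (1 + t)" b] by (simp del: of_real_add)
    also have "\<dots> \<le> t * f (b + w) + f ?x"
      using norm_triangle[of "scale (of_real t) (b + w)" ?x] norm_scale[of "of_real t" "b + w"] t
      by simp
    \<comment> \<open>The zeroth-order terms \<open>f b\<close> cancel, so everything left carries a
      factor \<open>t\<close>, and the quadratic error becomes linear after division.\<close>
    finally have "t * ((1 - t * r / 2) * f b) \<le> t * f (b + w)"
      using x by (simp add: algebra_simps power2_eq_square)
    then show ?thesis using t by simp
  qed
  have "((\<lambda>t. (1 - t * r / 2) * f b) \<longlongrightarrow> (1 - 0 * r / 2) * f b) (at_right 0)"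
    by (intro tendsto_intros) simp
  moreover have "\<forall>\<^sub>F t in at_right 0. (1 - t * r / 2) * f b \<le> f (b + w)"
    using approx by (auto simp: eventually_at_filter)
  ultimately show ?thesis
    by (auto dest!: tendsto_upperbound)
qed

lemma coefficient_mult_norm_le:
  assumes U: "subspace U" and b: "is_arg_max f (\<lambda>b. b \<in> U \<inter> unit_sphere) b" and v: "v \<in> U"
  shows "norm (ip v b) * f b \<le> f v"
proof (cases "ip v b = 0")
  case True
  then show ?thesis by (simp add: norm_nonneg)
next
  case False
  define a where "a = ip v b"
  have bU: "b \<in> U" and bb: "ip b b = 1"
    using b by (auto simp: is_arg_max_def unit_sphere_def)
  \<comment> \<open>Dividing \<open>v\<close> by its coefficient moves it to the affine hyperplane
    through \<open>b\<close> orthogonal to \<open>b\<close>.\<close>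
  let ?w = "scale (1 / a) v - b"
  have "?w \<in> U" using U v bU by (simp add: subspace_diff subspace_scale)
  moreover have "ip ?w b = 0"
    using False bb by (simp add: ip_diff_left ip_scale_left a_def)
  ultimately have "f b \<le> f (scale (1 / a) v)"
    using norm_arg_max_le[OF U b] by fastforce
  also have "\<dots> = f v / norm a" by (simp add: norm_scale norm_divide)
  finally show ?thesis using False by (simp add: a_def field_simps)
qed

section \<open>Bases and dimension of the orthogonal complement of a unit vector\<close>

lemma subspace_orthogonal:
  assumes "subspace U"
  shows "subspace {u \<in> U. ip u b = 0}"
  using assms by (auto simp: subspace_def ip_zero_left ip_add_left ip_scale_left)

text \<open>Since \<open>ip b b = 1\<close>, \<open>b\<close> lies outside the complement, and
  subtracting \<open>scale (ip u b) b\<close> brings any \<open>u\<close> of \<open>U\<close> into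
  it.\<close>

lemma orthogonal_basis_extend:
  assumes U: "subspace U" and b: "b \<in> U" "ip b b = 1"
    and B: "independent B" "span B = {u \<in> U. ip u b = 0}"
  shows "independent (insert b B)" "span (insert b B) = U" "b \<notin> B"
proof -
  have nb: "b \<notin> span B" using b B by auto
  then show "independent (insert b B)" "b \<notin> B"
    using B(1) by (auto simp: independent_insert span_base)
  show "span (insert b B) = U"
  proof
    have "B \<subseteq> U" using B(2) span_superset by blast
    then show "span (insert b B) \<subseteq> U" using U b by (intro span_minimal) auto
    show "U \<subseteq> span (insert b B)"
    proof
      fix u assume "u \<in> U"
      then have "u - scale (ip u b) b \<in> span B"
        using B(2) U b by (simp add: subspace_diff subspace_scale ip_diff_left ip_scale_left)
      then show "u \<in> span (insert b B)" by (auto simp: span_insert)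
    qed
  qed
qed

lemma orthogonal_basis_exists:
  assumes "subspace U"
  obtains B where "independent B" "span B = {u \<in> U. ip u b = 0}"
  by (metis assms maximal_independent_subset span_subspace subspace_orthogonal)

lemma dim_orthogonal:
  assumes U: "subspace U" and b: "b \<in> U" "ip b b = 1" and d: "dim U > 0"
  shows "dim U = Suc (dim {u \<in> U. ip u b = 0})"
proof -
  obtain B where B: "independent B" "span B = {u \<in> U. ip u b = 0}"
    using orthogonal_basis_exists[OF U] by blast
  note * = orthogonal_basis_extend[OF U b B]
  have dU: "dim U = card (insert b B)"
    using *(1,2) by (metis dim_span dim_eq_card_independent)
  \<comment> \<open>An infinite set has \<open>card\<close> 0, so positive dimension forces a finite
    basis.\<close>
  then have "finite B" using d card_gt_0_iff by fastforce
  moreover have "dim {u \<in> U. ip u b = 0} = card B"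
    using B by (metis dim_span dim_eq_card_independent)
  ultimately show ?thesis using dU *(3) by simp
qed

lemma one_dimensional_eq_scale:
  assumes U: "subspace U" and b: "b \<in> U" "ip b b = 1" and d: "dim U = 1" and v: "v \<in> U"
  shows "v = scale (ip v b) b"
proof -
  obtain B where B: "independent B" "span B = {u \<in> U. ip u b = 0}"
    using orthogonal_basis_exists[OF U] by blast
  note * = orthogonal_basis_extend[OF U b B]
  have dU: "card (insert b B) = 1"
    using *(1,2) d by (metis dim_span dim_eq_card_independent)
  then have "B = {}" using *(3) by (auto simp: card_1_singleton_iff)
  then have "v \<in> span {b}" using v *(2) by simp
  then obtain k where "v = scale k b" by (auto simp: span_singleton)
  then show ?thesis using b by (simp add: ip_scale_left)
qed

section \<open>Induction along the maximal basis\<close>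

text \<open>The claims are proved together because the bound needs the inclusion: it makes the later
  basis vectors orthogonal to the first. The length identifies the exponent with the
  dimension.\<close>

lemma maximal_basis_bound:
  assumes "maximal_basis f U bs" and "subspace U"
  shows "length bs = dim U" "set bs \<subseteq> U"
    "v \<in> U \<Longrightarrow> (\<Sum>i<length bs. norm (ip v (bs ! i)) * f (bs ! i)) \<le> (2 ^ length bs - 1) * f v"
  using assms
proof (induction arbitrary: v)
  case (one U b)
  {
    case 1 then show ?case using one by simp
  next
    case 2 then show ?case using one by simp
  next
    case (3 v)
    then have "v = scale (ip v b) b"
      using one by (intro one_dimensional_eq_scale) (auto simp: unit_sphere_def)
    then have "f v = norm (ip v b) * f b" by (metis norm_scale)
    then show ?case by simp
  }
next
  case (step U b bs)
  let ?U' = "{u \<in> U. ip u b = 0}"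
  have b: "b \<in> U" "ip b b = 1"
    using step.hyps by (auto simp: is_arg_max_def unit_sphere_def)
  {
    case 1
    then show ?case
      using step.IH(1) dim_orthogonal[OF _ b] step.hyps(1) subspace_orthogonal by simp
  next
    case 2
    then show ?case using step.IH(2) b subspace_orthogonal by auto
  next
    case (3 v)
    note U = \<open>subspace U\<close>
    define w where "w = v - scale (ip v b) b"
    have w: "w \<in> ?U'"
      using 3 b by (simp add: w_def subspace_diff subspace_scale ip_diff_left ip_scale_left)
    have fst: "norm (ip v b) * f b \<le> f v"
      using coefficient_mult_norm_le step.hyps(2) 3 by blast
    have "f w \<le> f v + norm (ip v b) * f b"
      using norm_triangle[of v "scale (- ip v b) b"] norm_scale[of "- ip v b" b]
      by (simp add: w_def)
    then have fw: "f w \<le> 2 * f v" using fst by simp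
    \<comment> \<open>Removing the \<open>b\<close>-component leaves the remaining coefficients
      unchanged, so the induction hypothesis for \<open>w\<close> applies to
      \<open>v\<close>.\<close>
    have "ip v (bs ! i) = ip w (bs ! i)" if "i < length bs" for i
    proof -
      have "bs ! i \<in> ?U'"
        using step.IH(2)[OF subspace_orthogonal[OF U]] that nth_mem by blast
      then have "ip b (bs ! i) = 0" by (simp add: ip_orthogonal_sym)
      then show ?thesis by (simp add: w_def ip_diff_left ip_scale_left)
    qed
    then have "(\<Sum>i<length bs. norm (ip v (bs ! i)) * f (bs ! i))
        = (\<Sum>i<length bs. norm (ip w (bs ! i)) * f (bs ! i))"
      by (intro sum.cong) auto
    also have "\<dots> \<le> (2 ^ length bs - 1) * f w"
      using step.IH(3)[OF w subspace_orthogonal[OF U]] .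
    also have "\<dots> \<le> (2 ^ length bs - 1) * (2 * f v)"
      using fw by (intro mult_left_mono) auto
    \<comment> \<open>Splitting off index 0, which is \<open>b\<close>, the constants combine as
      \<open>1 + 2 * (2 ^ k - 1) = 2 ^ Suc k - 1\<close> with \<open>k = length bs\<close>.\<close>
    finally show ?case
      using fst by (simp add: sum.lessThan_Suc_shift algebra_simps del: sum.lessThan_Suc)
  }
qed

corollary maximal_basis_UNIV_bound:
  assumes "maximal_basis f UNIV bs" and "dim UNIV = n"
  shows "(\<Sum>i<n. norm (ip v (bs ! i)) * f (bs ! i)) \<le> (2 ^ n - 1) * f v"
  using maximal_basis_bound[OF assms(1)] assms(2) by auto

end

theorem theorem5:
  fixes n :: nat
  assumes "n \<ge> 1"
  shows
    "(\<forall>(scale :: real \<Rightarrow> 'v::ab_group_add \<Rightarrow> 'v) ip f bs v.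
        scalar_product_space scale (\<lambda>a. a) ip \<longrightarrow>
        vector_space.dim scale UNIV = n \<longrightarrow>
        norm_on_vector_space scale f \<longrightarrow>
        scalar_product_space.maximal_basis scale ip f UNIV bs \<longrightarrow>
        (2 ^ n - 1) * f v \<ge> (\<Sum>i<n. \<bar>ip v (bs ! i)\<bar> * f (bs ! i)))
   \<and> (\<forall>(scale :: complex \<Rightarrow> 'w::ab_group_add \<Rightarrow> 'w) ip f bs v.
        scalar_product_space scale cnj ip \<longrightarrow>
        vector_space.dim scale UNIV = n \<longrightarrow>
        norm_on_vector_space scale f \<longrightarrow>
        scalar_product_space.maximal_basis scale ip f UNIV bs \<longrightarrow>
        (2 ^ n - 1) * f v \<ge> (\<Sum>i<n. cmod (ip v (bs ! i)) * f (bs ! i)))"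
proof (intro conjI allI impI)
  fix scale :: "real \<Rightarrow> 'v \<Rightarrow> 'v" and ip f bs v
  assume "scalar_product_space scale (\<lambda>a. a) ip" "norm_on_vector_space scale f"
    and *: "vector_space.dim scale UNIV = n" "scalar_product_space.maximal_basis scale ip f UNIV bs"
  then interpret normed_scalar_product_space scale "\<lambda>a. a" ip f
    by (intro normed_scalar_product_space.intro normed_scalar_product_space_axioms.intro) auto
  show "(2 ^ n - 1) * f v \<ge> (\<Sum>i<n. \<bar>ip v (bs ! i)\<bar> * f (bs ! i))"
    using maximal_basis_UNIV_bound * by simp
next
  fix scale :: "complex \<Rightarrow> 'w \<Rightarrow> 'w" and ip f bs v
  assume "scalar_product_space scale cnj ip" "norm_on_vector_space scale f"
    and *: "vector_space.dim scale UNIV = n" "scalar_product_space.maximal_basis scale ip f UNIV bs"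
  then interpret normed_scalar_product_space scale cnj ip f
    by (intro normed_scalar_product_space.intro normed_scalar_product_space_axioms.intro) auto
  show "(2 ^ n - 1) * f v \<ge> (\<Sum>i<n. cmod (ip v (bs ! i)) * f (bs ! i))"
    using maximal_basis_UNIV_bound * by simp
qed

end
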